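(* Let $q \in \mathbb{C}$ with $q \neq 0$ and $q$ not a root of unity. Let $f, p \in \mathbb{C}[[x]]$ be formal power series with $f_{.0} = 0$ and $f_{.1} = 1$, satisfying Poincar\'{e}'s functional equation $$f \circ (q x) = p \circ f .$$ (This forces $p_{.0}=0$ and $p_{.1}=q$, so all compositional iterates $p^{\circ i}$ are defined, with $p^{\circ 0} = x$.) Let $j \geqslant 1$ and let $g_j \in \mathbb{C}[x]$ be an arbitrary nonzero polynomial of $q$-difference order $j$, i.e. $g_j(q^m) = 0$ for all integers $0 \leqslant m < j$ and $g_j(q^j) \neq 0$. Then $$f_{.j} = \frac{1}{g_j(q^j)} \sum_{i \geqslant 0} g_{j.i}\, (p^{\circ i})_{.j} .$$
   Context: For a formal power series (or polynomial) $h$, $h_{.j}$ denotes the coefficient of $x^j$ in $h$; thus $g_{j.i}$ is the coefficient of $x^i$ in the polynomial $g_j$, and $(p^{\circ i})_{.j}$ is the coefficient of $x^j$ in the $i$-fold compositional iterate $p^{\circ i} = p \circ \cdots \circ p$ ($i$ times), with $p^{\circ 0} = x$ the identity series. Composition $h \circ k$ of formal power series is defined when $k_{.0}=0$ by $(h\circ k)_{.j} = \sum_{0 \le l \le j} h_{.l} (k^l)_{.j}$. The "$q$-difference order" of a nonzero polynomial $g$ is the smallest nonnegative integer $n$ with $g(q^n) \neq 0$. *)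

theory Defs
  imports Complex_Main "HOL-Computational_Algebra.Computational_Algebra"
begin

unbundle fps_syntax

text \<open>Only meaningful when the constant coefficient of \<open>p\<close> is zero, since \<^const>\<open>fps_compose\<close>
  is a total operation.\<close>

definition fps_iterate :: "'a::comm_ring_1 fps \<Rightarrow> nat \<Rightarrow> 'a fps" where
  "fps_iterate p n = ((\<lambda>h. p oo h) ^^ n) fps_X"

text \<open>Only meaningful when \<open>g\<close> is nonzero at some power of \<open>q\<close>; this holds for every
  nonzero \<open>g\<close> if \<open>q\<close> is nonzero and not a root of unity.\<close>

definition q_difference_order :: "'a::comm_ring_1 \<Rightarrow> 'a poly \<Rightarrow> nat" where
  "q_difference_order q g = (LEAST n. poly g (q ^ n) \<noteq> 0)"

end

(* Iterating the functional equation gives p^(i) o f = f(q^i x), where p^(i) is the i-fold iterate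
   of p. Hence the series h = sum_i g_i p^(i) satisfies (h o f)_m = g(q^m) f_m for every m, which
   vanishes for m < j. As f = x + ..., composition with f preserves the lowest-order term,
   so h_j = (h o f)_j = g(q^j) f_j. *)

theory Submission
  imports Defs
begin

lemma fps_iterate_0: "fps_iterate p 0 = fps_X"
  by (simp add: fps_iterate_def)

lemma fps_iterate_Suc: "fps_iterate p (Suc n) = p oo fps_iterate p n"
  by (simp add: fps_iterate_def)

lemma fps_iterate_nth_0:
  assumes "p $ 0 = 0"
  shows "fps_iterate p n $ 0 = 0"
  using assms by (cases n) (simp_all add: fps_iterate_0 fps_iterate_Suc)

text \<open>Associativity lets \<open>f\<close> pass the factors \<open>p\<close> one at a time,
  each turning into \<open>s\<close> by \<open>eq\<close>. The vanishing constant terms are what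
  makes reassociating legitimate. It is applied with \<open>s\<close> equal to
  \<open>q x\<close>.\<close>

lemma fps_iterate_compose_intertwine:
  fixes p f s :: "'a::idom fps"
  assumes "p $ 0 = 0" "f $ 0 = 0" "s $ 0 = 0" and eq: "f oo s = p oo f"
  shows "fps_iterate p n oo f = f oo fps_iterate s n"
proof (induction n)
  case 0
  show ?case using assms by (simp add: fps_iterate_0)
next
  case (Suc n)
  have s0: "fps_iterate s n $ 0 = 0" and p0: "fps_iterate p n $ 0 = 0"
    using assms by (simp_all add: fps_iterate_nth_0)
  have "fps_iterate p (Suc n) oo f = p oo (fps_iterate p n oo f)"
    using p0 assms by (simp add: fps_iterate_Suc fps_compose_assoc)
  also have "\<dots> = (p oo f) oo fps_iterate s n"
    using s0 assms by (simp add: Suc fps_compose_assoc)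
  also have "\<dots> = f oo fps_iterate s (Suc n)"
    using s0 assms by (simp add: fps_iterate_Suc fps_compose_assoc flip: eq)
  finally show ?case .
qed

lemma fps_iterate_linear:
  fixes q :: "'a::idom"
  shows "fps_iterate (fps_const q * fps_X) n = fps_const (q ^ n) * fps_X"
proof (induction n)
  case 0
  show ?case by (simp add: fps_iterate_0)
next
  case (Suc n)
  show ?case
    by (simp add: fps_iterate_Suc Suc fps_compose_mult_distrib mult.assoc flip: fps_const_mult)
qed

text \<open>The powers of \<open>f\<close> above the \<open>m\<close>-th start beyond degree
  \<open>m\<close>, and the lower ones carry zero coefficients of \<open>h\<close>; the surviving
  power \<open>f ^ m\<close> has leading coefficient \<open>(f $ 1) ^ m\<close>.\<close>

lemma fps_compose_nth_lowest:
  fixes h f :: "'a::idom fps"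
  assumes "f $ 0 = 0" and "\<And>i. i < m \<Longrightarrow> h $ i = 0"
  shows "(h oo f) $ m = h $ m * (f $ 1) ^ m"
proof -
  have "(h oo f) $ m = (\<Sum>i=0..m. if i = m then h $ m * f ^ m $ m else 0)"
    unfolding fps_compose_nth using assms(2) by (intro sum.cong) auto
  then show ?thesis
    using assms(1) by (simp add: startsby_zero_power_nth_same)
qed

text \<open>Strong induction clears the coefficients of \<open>h\<close> below \<open>j\<close>:
  once all earlier ones vanish, the next equals that of \<open>h oo f\<close>, because
  \<open>f $ 1 = 1\<close>. The same identity is then read off at \<open>j\<close>.\<close>

lemma fps_compose_lowest_nth_eq:
  fixes h f :: "'a::idom fps"
  assumes f: "f $ 0 = 0" "f $ 1 = 1" and "\<And>m. m < j \<Longrightarrow> (h oo f) $ m = 0"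
  shows "h $ j = (h oo f) $ j"
proof -
  have "h $ m = 0" if "m < j" for m
    using that
  proof (induction m rule: less_induct)
    case (less m)
    then show ?case
      using fps_compose_nth_lowest[of f m h] f assms(3)[of m] by simp
  qed
  then show ?thesis
    using fps_compose_nth_lowest[of f j h] f by simp
qed

lemma root_of_unity_if_powers_eq:
  fixes q :: "'a::idom"
  assumes "q \<noteq> 0" "q ^ m = q ^ n" "m < n"
  shows "\<exists>k>0. q ^ k = 1"
proof -
  have "q ^ m * q ^ (n - m) = q ^ m * 1"
    using assms(2,3) power_add[of q m "n - m"] by simp
  then have "q ^ (n - m) = 1"
    using assms(1) by simp
  with assms(3) show ?thesis
    by (intro exI[of _ "n - m"]) simp
qed

text \<open>The powers of \<open>q\<close> are pairwise distinct, too many to be all roots of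
  \<open>g\<close>. This ensures that the \<open>LEAST\<close> in \<open>q_difference_order\<close>
  is attained.\<close>

lemma ex_poly_power_nonzero:
  fixes q :: "'a::idom"
  assumes "q \<noteq> 0" "\<forall>n>0. q ^ n \<noteq> 1" "g \<noteq> 0"
  shows "\<exists>n. poly g (q ^ n) \<noteq> 0"
proof (rule ccontr)
  assume "\<not> ?thesis"
  then have "range (\<lambda>n. q ^ n) \<subseteq> {x. poly g x = 0}"
    by auto
  then have "finite (range (\<lambda>n. q ^ n))"
    using poly_roots_finite[OF \<open>g \<noteq> 0\<close>] finite_subset by blast
  moreover have "inj (\<lambda>n. q ^ n)"
    by (rule linorder_injI) (use root_of_unity_if_powers_eq assms in blast)
  ultimately show False
    using finite_imageD infinite_UNIV_nat by blast
qed

theorem mainTheorem1: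
  fixes q :: complex
    and f p :: "complex fps"
    and g :: "complex poly"
    and j :: nat
  assumes "q \<noteq> 0"
    and "\<forall>n>0. q ^ n \<noteq> 1"
    and "f $ 0 = 0"
    and "f $ 1 = 1"
    and "f oo (fps_const q * fps_X) = p oo f"
    and "j \<ge> 1"
    and "g \<noteq> 0"
    and "q_difference_order q g = j"
  shows "f $ j = 1 / poly g (q ^ j) * (\<Sum>i\<le>degree g. coeff g i * fps_iterate p i $ j)"
proof -
  have j: "j = (LEAST n. poly g (q ^ n) \<noteq> 0)"
    using assms(8) by (simp add: q_difference_order_def)
  have nz: "poly g (q ^ j) \<noteq> 0"
    unfolding j using ex_poly_power_nonzero[OF assms(1,2,7)] by (rule LeastI_ex)
  have zero: "poly g (q ^ m) = 0" if "m < j" for m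
    using that not_less_Least unfolding j by blast
  \<comment> \<open>Compare constant terms in the functional equation: the left side gives
    \<open>f $ 0\<close>, the right side \<open>p $ 0\<close>.\<close>
  have p0: "p $ 0 = 0"
    using arg_cong[OF assms(5), of "\<lambda>h. h $ 0"] assms(3) by simp
  define h where "h = (\<Sum>i\<le>degree g. fps_const (coeff g i) * fps_iterate p i)"
  have hf: "(h oo f) $ m = poly g (q ^ m) * f $ m" for m
  proof -
    have "h oo f = (\<Sum>i\<le>degree g. fps_const (coeff g i) * (fps_iterate p i oo f))"
      using assms(3) by (simp add: h_def fps_compose_sum_distrib fps_compose_mult_distrib)
    also have "\<dots> = (\<Sum>i\<le>degree g. fps_const (coeff g i) * (f oo (fps_const (q ^ i) * fps_X)))"
      using fps_iterate_compose_intertwine[OF p0 assms(3) _ assms(5)]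
      by (simp add: fps_iterate_linear)
    \<comment> \<open>Scaling \<open>x\<close> by \<open>q ^ i\<close> multiplies the
      \<open>m\<close>-th coefficient by \<open>(q ^ i) ^ m\<close>; exchanging the exponents turns
      the sum into \<open>g\<close> evaluated at \<open>q ^ m\<close>.\<close>
    also have "\<dots> $ m = (\<Sum>i\<le>degree g. coeff g i * (q ^ m) ^ i) * f $ m"
      by (simp add: fps_compose_linear fps_sum_nth sum_distrib_right mult.assoc)
        (simp add: mult.commute flip: power_mult)
    finally show ?thesis
      by (simp add: poly_altdef)
  qed
  have "h $ j = poly g (q ^ j) * f $ j"
    using fps_compose_lowest_nth_eq[of f j h] assms(3,4) zero by (simp add: hf)
  moreover have "h $ j = (\<Sum>i\<le>degree g. coeff g i * fps_iterate p i $ j)"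
    by (simp add: h_def fps_sum_nth)
  ultimately show ?thesis
    using nz by (simp add: field_simps)
qed

end
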